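(* Let $G$ be a connected split graph with at least one edge, with a fixed partition $V(G)=C\sqcup I$ where $C$ induces a clique and $I$ is an independent set. Let $m=|I|$ and, for $c\in C$, let $a(c)=|I\setminus N_G(c)|$. Then the independence polynomial of $G$ is $$P_G(x)=(1+x)^m+x\sum_{c\in C}(1+x)^{a(c)}.$$
   Context: A split graph is a graph whose vertex set admits a partition $C\sqcup I$ with $C$ inducing a clique and $I$ inducing an independent set; $N_G(c)$ is the set of neighbors of $c$. The independence polynomial is $P_G(x)=\sum_{j\ge0}g_jx^j$, where $g_j$ is the number of independent sets of $G$ of size $j$. *)

theory Defs
  imports
    "Graph_Theory.Graph_Theory"
    "HOL-Computational_Algebra.Polynomial"
begin

text \<open>
  A finite simple graph is a finite symmetric digraph without loops and multiple arcs
  (locale \<^locale>\<open>graph\<close>): an undirected edge is a pair of opposite arcs, and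
  \<^term>\<open>u \<rightarrow>\<^bsub>G\<^esub> v\<close> says that \<^term>\<open>u\<close> and \<^term>\<open>v\<close> are adjacent.
\<close>

definition clique :: "('a, 'b) pre_digraph \<Rightarrow> 'a set \<Rightarrow> bool" where
  "clique G C \<longleftrightarrow> C \<subseteq> verts G \<and> (\<forall>u\<in>C. \<forall>v\<in>C. u \<noteq> v \<longrightarrow> u \<rightarrow>\<^bsub>G\<^esub> v)"

definition independent_set :: "('a, 'b) pre_digraph \<Rightarrow> 'a set \<Rightarrow> bool" where
  "independent_set G S \<longleftrightarrow> S \<subseteq> verts G \<and> (\<forall>u\<in>S. \<forall>v\<in>S. \<not> u \<rightarrow>\<^bsub>G\<^esub> v)"

definition neighbors :: "('a, 'b) pre_digraph \<Rightarrow> 'a \<Rightarrow> 'a set" where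
  "neighbors G c = {v \<in> verts G. c \<rightarrow>\<^bsub>G\<^esub> v}"

text \<open>Either part of a split partition may be empty.\<close>

definition split_partition :: "('a, 'b) pre_digraph \<Rightarrow> 'a set \<Rightarrow> 'a set \<Rightarrow> bool" where
  "split_partition G C I \<longleftrightarrow>
     verts G = C \<union> I \<and> C \<inter> I = {} \<and> clique G C \<and> independent_set G I"

definition num_independent_sets :: "('a, 'b) pre_digraph \<Rightarrow> nat \<Rightarrow> nat" where
  "num_independent_sets G j = card {S. independent_set G S \<and> card S = j}"

text \<open>
  The sum over all sizes stops at the number of vertices, since no larger independent
  set exists; the lemma below gives every coefficient.
\<close>

definition independence_poly :: "('a, 'b) pre_digraph \<Rightarrow> int poly" where
  "independence_poly G =
     (\<Sum>j\<le>card (verts G). monom (int (num_independent_sets G j)) j)"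

lemma coeff_independence_poly:
  assumes "finite (verts G)"
  shows "coeff (independence_poly G) j = int (num_independent_sets G j)"
proof (cases "j \<le> card (verts G)")
  case True
  then show ?thesis
    by (simp add: independence_poly_def coeff_sum)
next
  case False
  then have none: "{S. independent_set G S \<and> card S = j} = {}"
    using assms card_mono[OF assms] by (auto simp: independent_set_def)
  have "num_independent_sets G j = 0"
    unfolding num_independent_sets_def none by simp
  with False show ?thesis
    by (simp add: independence_poly_def coeff_sum)
qed

end

theory Submission
  imports Defs
begin

text \<open>
  The coefficients of the independence polynomial count independent sets by size, so the
  polynomial is the generating function summing \<open>x\<close> to the power \<open>|S|\<close> over all independent
  sets \<open>S\<close>. An independent set contains at most one vertex of the clique \<open>C\<close>. If it contains
  none, it is an arbitrary subset of \<open>I\<close>; if it contains exactly \<open>c\<close>, the remaining vertices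
  form an arbitrary subset of the non-neighbours of \<open>c\<close> in \<open>I\<close>, since \<open>I\<close> has no internal
  edges (lemma \<open>independent_sets_split\<close>). The subsets of a set of size \<open>n\<close> have generating
  function \<open>(1 + x)\<close> to the power \<open>n\<close> (lemma \<open>sum_Pow_monom_card\<close>), and adjoining \<open>c\<close>
  multiplies by \<open>x\<close>.
\<close>

lemma independence_poly_eq_sum_monom_card:
  assumes "finite (verts G)"
  shows "independence_poly G = (\<Sum>S | independent_set G S. monom 1 (card S))"
proof (rule poly_eqI)
  fix j
  have fin: "finite {S. independent_set G S}"
    by (rule finite_subset[of _ "Pow (verts G)"]) (auto simp: independent_set_def assms)
  have "{S. independent_set G S} \<inter> {S. card S = j} = {S. independent_set G S \<and> card S = j}"
    by auto
  then have "coeff (\<Sum>S | independent_set G S. monom (1::int) (card S)) j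
      = int (num_independent_sets G j)"
    by (simp add: coeff_sum fin sum.If_cases num_independent_sets_def)
  then show "coeff (independence_poly G) j
      = coeff (\<Sum>S | independent_set G S. monom 1 (card S)) j"
    by (simp add: coeff_independence_poly[OF assms])
qed

lemma sum_insert_Pow_monom_card:
  assumes "finite A" and "c \<notin> A"
  shows "(\<Sum>T\<in>insert c ` Pow A. monom (1 :: 'a::comm_semiring_1) (card T))
    = [:0, 1:] * (\<Sum>T\<in>Pow A. monom 1 (card T))"
proof -
  have inj: "inj_on (insert c) (Pow A)"
    using assms by (auto intro!: inj_onI)
  have "monom (1::'a) (card (insert c T)) = [:0, 1:] * monom 1 (card T)" if "T \<in> Pow A" for T
  proof -
    have "finite T" "c \<notin> T"
      using that assms by (auto intro: finite_subset)
    then show ?thesis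
      by (simp add: monom_Suc)
  qed
  then show ?thesis
    unfolding sum_distrib_left by (simp add: sum.reindex[OF inj])
qed

text \<open>
  Expanding the product of \<open>|A|\<close> factors \<open>1 + x\<close> chooses the summand \<open>x\<close> for exactly the
  elements of one subset of \<open>A\<close>. In the induction, the subsets of \<open>insert c A\<close> split into
  those without \<open>c\<close>, contributing the factor \<open>1\<close>, and those with \<open>c\<close>, contributing \<open>x\<close>.
\<close>

lemma sum_Pow_monom_card:
  assumes "finite A"
  shows "(\<Sum>T\<in>Pow A. monom 1 (card T)) = ([:1, 1:] ^ card A :: 'a::comm_semiring_1 poly)"
  using assms
proof (induction A rule: finite_induct)
  case (insert c A)
  let ?w = "\<lambda>T. monom (1::'a) (card T)"
  have "sum ?w (Pow (insert c A)) = sum ?w (Pow A) + sum ?w (insert c ` Pow A)"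
    unfolding Pow_insert using insert.hyps by (intro sum.union_disjoint) auto
  also have "\<dots> = (1 + [:0, 1:]) * sum ?w (Pow A)"
    unfolding sum_insert_Pow_monom_card[OF insert.hyps] by (simp only: distrib_right mult_1_left)
  also have "1 + [:0, 1:] = ([:1, 1:] :: 'a poly)"
    by (simp add: one_pCons)
  finally show ?case
    using insert by simp
qed simp

text \<open>
  Two vertices of the clique cannot both lie in an independent set, so such a set is decided by
  its clique vertex, if any, and its part in \<open>I\<close>. As \<open>C\<close> and \<open>I\<close> are disjoint, the families
  on the right are pairwise disjoint, which turns this union into a sum of generating functions.
\<close>

lemma independent_sets_split:
  assumes "graph G" and split: "split_partition G C I"
  shows "{S. independent_set G S}
    = Pow I \<union> (\<Union>c\<in>C. insert c ` Pow (I - neighbors G c))"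
proof -
  interpret graph G by fact
  have verts: "verts G = C \<union> I" and "clique G C" and indep: "independent_set G I"
    using split by (auto simp: split_partition_def)
  have sym: "v \<rightarrow>\<^bsub>G\<^esub> u" if "u \<rightarrow>\<^bsub>G\<^esub> v" for u v
    using that sym_arcs by (auto simp: symmetric_def dest: symD)
  show ?thesis
  proof (intro equalityI subsetI)
    fix S assume "S \<in> {S. independent_set G S}"
    then have S: "S \<subseteq> C \<union> I" "\<And>u v. u \<in> S \<Longrightarrow> v \<in> S \<Longrightarrow> \<not> u \<rightarrow>\<^bsub>G\<^esub> v"
      by (auto simp: independent_set_def verts)
    show "S \<in> Pow I \<union> (\<Union>c\<in>C. insert c ` Pow (I - neighbors G c))"
    proof (cases "S \<subseteq> I")
      case False
      then obtain c where c: "c \<in> S" "c \<in> C"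
        using S(1) by blast
      \<comment> \<open>Any other clique vertex in \<open>S\<close> would be adjacent to \<open>c\<close>.\<close>
      have "S - {c} \<subseteq> I - neighbors G c"
        using c S \<open>clique G C\<close> by (fastforce simp: clique_def neighbors_def)
      moreover have "S = insert c (S - {c})"
        using c by blast
      ultimately show ?thesis
        using c by blast
    qed simp
  next
    fix S assume "S \<in> Pow I \<union> (\<Union>c\<in>C. insert c ` Pow (I - neighbors G c))"
    then consider "S \<subseteq> I"
      | c T where "c \<in> C" "T \<subseteq> I - neighbors G c" "S = insert c T"
      by blast
    then show "S \<in> {S. independent_set G S}"
    proof cases
      case 1
      then show ?thesis
        using indep by (auto simp: independent_set_def)
    next
      case 2
      have "\<not> c \<rightarrow>\<^bsub>G\<^esub> v" "\<not> v \<rightarrow>\<^bsub>G\<^esub> c" if "v \<in> T" for v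
        using that 2 sym by (auto simp: neighbors_def verts)
      moreover have "\<not> c \<rightarrow>\<^bsub>G\<^esub> c"
        using adj_not_same by blast
      ultimately show ?thesis
        using 2 indep unfolding independent_set_def verts by blast
    qed
  qed
qed

theorem proposition8p4:
  fixes G :: "('a, 'b) pre_digraph" and C I :: "'a set" and m :: nat and a :: "'a \<Rightarrow> nat"
  assumes "graph G"
    and "Digraph_Component.connected G"
    and "arcs G \<noteq> {}"
    and "split_partition G C I"
    and "m = card I"
    and "\<And>c. c \<in> C \<Longrightarrow> a c = card (I - neighbors G c)"
  shows "independence_poly G = [:1, 1:] ^ m + [:0, 1:] * (\<Sum>c\<in>C. [:1, 1:] ^ a c)"
proof -
  interpret graph G by fact
  let ?w = "\<lambda>S. monom (1::int) (card S)"
  let ?F = "\<lambda>c. insert c ` Pow (I - neighbors G c)"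
  have part: "C \<inter> I = {}" and fin: "finite C" "finite I"
    using \<open>split_partition G C I\<close> finite_verts by (auto simp: split_partition_def)
  have star: "sum ?w (?F c) = [:0, 1:] * [:1, 1:] ^ a c" if "c \<in> C" for c
  proof -
    have *: "finite (I - neighbors G c)" "c \<notin> I - neighbors G c"
      using part that fin by auto
    then show ?thesis
      unfolding sum_insert_Pow_monom_card[OF *]
      using * assms(6)[OF that] by (simp only: sum_Pow_monom_card)
  qed
  have "independence_poly G = sum ?w (Pow I \<union> (\<Union>c\<in>C. ?F c))"
    using assms by (simp add: independence_poly_eq_sum_monom_card independent_sets_split)
  also have "\<dots> = sum ?w (Pow I) + sum ?w (\<Union>c\<in>C. ?F c)"
    using fin part by (intro sum.union_disjoint) auto
  also have "sum ?w (\<Union>c\<in>C. ?F c) = (\<Sum>c\<in>C. sum ?w (?F c))"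
    using fin part by (intro sum.UNION_disjoint) auto
  finally show ?thesis
    using fin assms(5) star by (simp add: sum_Pow_monom_card sum_distrib_left)
qed

end
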